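(* For any constant deletion probability $p<1$, $O(\log n)$ traces from the matrix deletion channel suffice to reconstruct a random matrix $X\in\{0,1\}^{\sqrt n\times\sqrt n}$, whose entries are independent $\mathrm{Ber}(1/2)$, with high probability over the randomness of $X$ and of the channel.
   Context: The matrix deletion channel with deletion probability $p$ takes $X\in\{0,1\}^{\sqrt n\times\sqrt n}$ and deletes each row and each column independently with probability $p$, outputting the submatrix formed by the surviving rows and columns (in their original relative order, without revealing which were deleted); each output is a trace. "With high probability" means with probability at least $1-o(1)$ as $n\to\infty$. *)

theory Defs
  imports
    "HOL-Probability.Probability"
    "HOL-Library.Landau_Symbols"
    "Jordan_Normal_Form.DL_Submatrix"
begin

(* Binary entries are booleans: True is 1 and False is 0. *)

definition random_matrix :: "nat \<Rightarrow> bool mat pmf" where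
  "random_matrix s =
     map_pmf (mat s s) (Pi_pmf ({..<s} \<times> {..<s}) False (\<lambda>_. bernoulli_pmf (1 / 2)))"

(* Indices that survive when each i < k is deleted independently with probability p.
   Inside Pi_pmf, True means "kept"; the default False makes the result a subset of {..<k}. *)
definition survivors :: "real \<Rightarrow> nat \<Rightarrow> nat set pmf" where
  "survivors p k = map_pmf Collect (Pi_pmf {..<k} False (\<lambda>_. bernoulli_pmf (1 - p)))"

definition matrix_deletion_channel :: "real \<Rightarrow> bool mat \<Rightarrow> bool mat pmf" where
  "matrix_deletion_channel p X = do {
     I \<leftarrow> survivors p (dim_row X);
     J \<leftarrow> survivors p (dim_col X);
     return_pmf (submatrix X I J)
   }"

(* Joint law of a random s x s matrix and of m traces of it, which are independent
   given the matrix. *)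
definition matrix_and_traces :: "real \<Rightarrow> nat \<Rightarrow> nat \<Rightarrow> (bool mat \<times> bool mat list) pmf" where
  "matrix_and_traces p s m = do {
     X \<leftarrow> random_matrix s;
     Ys \<leftarrow> replicate_pmf m (matrix_deletion_channel p X);
     return_pmf (X, Ys)
   }"

end

theory Submission
  imports Defs "HOL-Real_Asymp.Real_Asymp"
begin

text \<open>
  Write \<open>q = 1 - p\<close> and \<open>c = q\<^sup>2\<close>. The decoder returns any matrix \<open>X'\<close> that explains the traces by
  row sets \<open>I' t\<close> and column sets \<open>J' t\<close> for which all pairwise intersections have about the expected
  size \<open>c * s\<close> and any two rows, any two columns, and any row and column survive together in some
  trace. The true survivor sets have this property with high probability as soon as there are
  \<open>2 / c * ln n\<close> traces.

  If \<open>X'\<close> explains the traces of \<open>X\<close>, then the order isomorphisms \<open>\<phi> t\<close> from \<open>I' t\<close> to the true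
  row set \<open>I t\<close>, and \<open>\<psi> t\<close> for the columns, satisfy
  \<open>X (\<phi> t i, \<psi> t j) = X (\<phi> u i, \<psi> u j)\<close> on the intersections. Each row with
  \<open>\<phi> t i \<noteq> \<phi> u i\<close> forces about \<open>c * s\<close> coincidences among independent bits, whereas there are only
  \<open>2 ^ (8 * s)\<close> choices of all sets involved; hence all but boundedly many rows, and likewise columns,
  satisfy \<open>\<phi> t i = \<phi> u i\<close>. A single remaining bad row would then make two distinct rows
  of \<open>X\<close> agree on almost all columns of \<open>J t \<inter> J u\<close>, which is also unlikely. So the \<open>\<phi> t\<close> glue
  to a strictly increasing map from \<open>{..<s}\<close> to itself, that is, to the identity, and \<open>X' = X\<close>.
\<close>

section \<open>Alignments of survivor sets\<close>

text \<open>The order isomorphism from \<open>I'\<close> to \<open>I\<close>, provided both have the same cardinality.\<close>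
definition align :: "nat set \<Rightarrow> nat set \<Rightarrow> nat \<Rightarrow> nat" where
  "align I' I i = pick I (card {a \<in> I'. a < i})"

lemma card_less_in_set:
  assumes "finite (I' :: nat set)" "i \<in> I'"
  shows "card {a \<in> I'. a < i} < card I'"
  using assms by (intro psubset_card_mono) auto

lemma align_in:
  assumes "finite I'" "card I = card I'" "i \<in> I'"
  shows "align I' I i \<in> I"
  unfolding align_def
  by (rule pick_in_set) (use assms card_less_in_set[of I' i] in auto)

lemma align_less:
  assumes "finite I'" "card I = card I'" "j \<in> I'" "i \<in> I'" "i < j"
  shows "align I' I i < align I' I j"
proof -
  have "{a \<in> I'. a < i} \<subset> {a \<in> I'. a < j}"
    using assms by auto
  then have "card {a \<in> I'. a < i} < card {a \<in> I'. a < j}"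
    using assms by (intro psubset_card_mono) auto
  then show ?thesis
    unfolding align_def
    by (intro pick_mono) (use assms card_less_in_set[of I' j] in auto)
qed

lemma align_inj:
  assumes "finite I'" "card I = card I'"
  shows "inj_on (align I' I) I'"
  by (rule linorder_inj_onI') (use align_less[OF assms] in \<open>metis less_irrefl\<close>)

text \<open>Entry \<open>(i, j)\<close> of \<open>X'\<close> stands in the trace at the ranks of
  \<open>i\<close> in \<open>I'\<close> and \<open>j\<close> in \<open>J'\<close>.
  \<open>pick\<close> turns the same position back into indices of the original matrix, and that
  composition is \<open>align\<close>.\<close>

lemma submatrix_align:
  assumes X': "X' \<in> carrier_mat s s"
    and sub: "I \<subseteq> {..<s}" "J \<subseteq> {..<s}" "I' \<subseteq> {..<s}" "J' \<subseteq> {..<s}"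
    and eq: "submatrix (mat s s x) I J = submatrix X' I' J'"
  shows "card I = card I'" "card J = card J'"
    and "\<And>i j. i \<in> I' \<Longrightarrow> j \<in> J' \<Longrightarrow> X' $$ (i, j) = x (align I' I i, align J' J j)"
proof -
  have c: "{i. i < s \<and> i \<in> A} = A" if "A \<subseteq> {..<s}" for A
    using that by auto
  show 1: "card I = card I'" "card J = card J'"
    using arg_cong[OF eq, of dim_row] arg_cong[OF eq, of dim_col] X' sub
    by (auto simp: dim_submatrix c)
  have fin: "finite I'" "finite J'"
    using sub finite_subset by blast+
  fix i j assume ij: "i \<in> I'" "j \<in> J'"
  have "X' $$ (i, j) = submatrix X' I' J' $$ (card {a \<in> I'. a < i}, card {a \<in> J'. a < j})"
    by (subst submatrix_index_card) (use X' sub ij in auto)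
  also have "\<dots> = mat s s x $$ (align I' I i, align J' J j)"
    unfolding eq[symmetric] align_def
    by (rule submatrix_index)
      (use sub ij 1 card_less_in_set[OF fin(1) ij(1)] card_less_in_set[OF fin(2) ij(2)] in
        \<open>auto simp: c\<close>)
  also have "\<dots> = x (align I' I i, align J' J j)"
    using sub align_in[OF fin(1) 1(1) ij(1)] align_in[OF fin(2) 1(2) ij(2)]
    by (intro index_mat) auto
  finally show "X' $$ (i, j) = x (align I' I i, align J' J j)" .
qed

section \<open>Coincidences forced by misaligned rows\<close>

text \<open>Only one direction of misalignment is counted: then every coincidence in \<open>coincident\<close> equates a
  bit with one in a strictly later row, which makes the coincidences independent.\<close>
definition misaligned :: "nat set \<Rightarrow> nat set \<Rightarrow> nat set \<Rightarrow> nat set \<Rightarrow> nat set" where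
  "misaligned I1' I1 I2' I2 = {i \<in> I1' \<inter> I2'. align I1' I1 i < align I2' I2 i}"

definition coincident ::
  "(nat \<times> nat \<Rightarrow> bool) \<Rightarrow> nat set \<Rightarrow> nat set \<Rightarrow> nat set \<Rightarrow> nat set \<Rightarrow> nat set \<Rightarrow>
   nat set \<Rightarrow> nat set \<Rightarrow> nat set \<Rightarrow> nat set \<Rightarrow> nat set \<Rightarrow> bool" where
  "coincident x A B I1' I1 I2' I2 J1' J1 J2' J2 \<longleftrightarrow>
     (\<forall>i\<in>A. \<forall>j\<in>B. x (align I1' I1 i, align J1' J1 j) = x (align I2' I2 i, align J2' J2 j))"

text \<open>The sets are quantified inside because a candidate explanation may depend on the bits
  \<open>x\<close>. The property thus concerns \<open>x\<close> alone, and a union bound over the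
  eight subsets covers every explanation at once.\<close>

definition self_similar :: "nat \<Rightarrow> nat \<Rightarrow> real \<Rightarrow> (nat \<times> nat \<Rightarrow> bool) \<Rightarrow> bool" where
  "self_similar s K L x \<longleftrightarrow>
     (\<exists>I1' I1 I2' I2 J1' J1 J2' J2.
        {I1', I1, I2', I2, J1', J1, J2', J2} \<subseteq> Pow {..<s} \<and>
        card I1 = card I1' \<and> card I2 = card I2' \<and> card J1 = card J1' \<and> card J2 = card J2' \<and>
        K \<le> card (misaligned I1' I1 I2' I2) \<and> L \<le> card (J1' \<inter> J2') \<and>
        coincident x (misaligned I1' I1 I2' I2) (J1' \<inter> J2') I1' I1 I2' I2 J1' J1 J2' J2)"

lemma self_similarI:
  fixes L :: real
  assumes "{I1', I1, I2', I2, J1', J1, J2', J2} \<subseteq> Pow {..<s}"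
    and "card I1 = card I1'" "card I2 = card I2'" "card J1 = card J1'" "card J2 = card J2'"
    and "K \<le> card (misaligned I1' I1 I2' I2)" "L \<le> card (J1' \<inter> J2')"
    and "coincident x (misaligned I1' I1 I2' I2) (J1' \<inter> J2') I1' I1 I2' I2 J1' J1 J2' J2"
  shows "self_similar s K L x"
  unfolding self_similar_def
  by (rule exI[of _ I1'], rule exI[of _ I1], rule exI[of _ I2'], rule exI[of _ I2],
      rule exI[of _ J1'], rule exI[of _ J1], rule exI[of _ J2'], rule exI[of _ J2],
      intro conjI; fact)

text \<open>Unlike in \<open>self_similar\<close>, the column set \<open>D\<close> is a parameter.
  It will be an intersection of true survivor sets, which are independent of \<open>x\<close>, so
  only the pairs of rows cost a union bound.\<close>

definition similar_rows :: "nat \<Rightarrow> real \<Rightarrow> nat set \<Rightarrow> (nat \<times> nat \<Rightarrow> bool) \<Rightarrow> bool" where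
  "similar_rows s \<theta> D x \<longleftrightarrow> (\<exists>a<s. \<exists>b<s. a \<noteq> b \<and> \<theta> \<le> card {j \<in> D. x (a, j) = x (b, j)})"

text \<open>The misaligned indices split by the direction of the inequality. Exchanging the two
  traces reverses the direction, so \<open>self_similar\<close> excludes \<open>K\<close> indices on
  either side.\<close>

lemma few_misaligned:
  fixes L :: real
  assumes "\<not> self_similar s K L x"
    and "{I1', I1, I2', I2, J1', J1, J2', J2} \<subseteq> Pow {..<s}"
    and "card I1 = card I1'" "card I2 = card I2'" "card J1 = card J1'" "card J2 = card J2'"
    and "L \<le> card (J1' \<inter> J2')"
    and co: "coincident x (I1' \<inter> I2') (J1' \<inter> J2') I1' I1 I2' I2 J1' J1 J2' J2"
  shows "card {i \<in> I1' \<inter> I2'. align I1' I1 i \<noteq> align I2' I2 i} < 2 * K"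
proof -
  have co1: "coincident x (misaligned I1' I1 I2' I2) (J1' \<inter> J2') I1' I1 I2' I2 J1' J1 J2' J2"
    using co by (auto simp: coincident_def misaligned_def)
  have co2: "coincident x (misaligned I2' I2 I1' I1) (J2' \<inter> J1') I2' I2 I1' I1 J2' J2 J1' J1"
    using co by (auto simp: coincident_def misaligned_def)
  have "\<not> K \<le> card (misaligned I1' I1 I2' I2)"
    using assms(1) self_similarI[OF assms(2-6) _ assms(7) co1] by (rule contrapos_nn)
  moreover have "\<not> K \<le> card (misaligned I2' I2 I1' I1)"
  proof
    assume K: "K \<le> card (misaligned I2' I2 I1' I1)"
    have "{I2', I2, I1', I1, J2', J2, J1', J1} \<subseteq> Pow {..<s}" "L \<le> card (J2' \<inter> J1')"
      using assms(2,7) by (simp_all add: Int_commute)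
    from self_similarI[OF this(1) assms(4,3,6,5) K this(2) co2] assms(1) show False
      by contradiction
  qed
  moreover have "{i \<in> I1' \<inter> I2'. align I1' I1 i \<noteq> align I2' I2 i}
      = misaligned I1' I1 I2' I2 \<union> misaligned I2' I2 I1' I1"
    by (auto simp: misaligned_def)
  ultimately show ?thesis
    using card_Un_le[of "misaligned I1' I1 I2' I2" "misaligned I2' I2 I1' I1"] by simp
qed

text \<open>On a column \<open>j\<close> that both traces send to the same true column
  \<open>k\<close>, the coincidence reads \<open>x (a, k) = x (b, k)\<close>, where \<open>a\<close>
  and \<open>b\<close> are the two images of row \<open>i\<close>. If \<open>a\<close> and
  \<open>b\<close> differed, they would be similar rows, since fewer than \<open>2 * K\<close>
  columns are lost.\<close>

lemma align_eq:
  assumes "\<not> similar_rows s \<theta> (J1 \<inter> J2) x"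
    and "{I1', I1, I2', I2, J1', J1, J2', J2} \<subseteq> Pow {..<s}"
    and "card I1 = card I1'" "card I2 = card I2'" "card J1 = card J1'" "card J2 = card J2'"
    and few: "card {j \<in> J1' \<inter> J2'. align J1' J1 j \<noteq> align J2' J2 j} < 2 * K"
    and many: "\<theta> + 2 * K \<le> card (J1' \<inter> J2')"
    and co: "coincident x (I1' \<inter> I2') (J1' \<inter> J2') I1' I1 I2' I2 J1' J1 J2' J2"
    and i: "i \<in> I1' \<inter> I2'"
  shows "align I1' I1 i = align I2' I2 i"
proof (rule ccontr)
  assume ne: "align I1' I1 i \<noteq> align I2' I2 i"
  have fin: "finite I1'" "finite I2'" "finite J1'" "finite J2'" "finite J1"
    using assms(2) by (auto intro: finite_subset)
  define G where "G = {j \<in> J1' \<inter> J2'. align J1' J1 j = align J2' J2 j}"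
  let ?a = "align I1' I1 i" and ?b = "align I2' I2 i"
  have "J1' \<inter> J2' = G \<union> {j \<in> J1' \<inter> J2'. align J1' J1 j \<noteq> align J2' J2 j}"
    by (auto simp: G_def)
  then have "card (J1' \<inter> J2') \<le> card G + card {j \<in> J1' \<inter> J2'. align J1' J1 j \<noteq> align J2' J2 j}"
    by (metis card_Un_le)
  then have "\<theta> \<le> card G"
    using few many by linarith
  \<comment> \<open>Agreement must be counted in true columns, which is what
    \<open>similar_rows\<close> sees; injectivity of the alignment preserves the count.\<close>
  also have "card G = card (align J1' J1 ` G)"
    by (rule card_image[symmetric])
      (rule inj_on_subset[OF align_inj], use fin assms in \<open>auto simp: G_def\<close>)
  also have "\<dots> \<le> card {j \<in> J1 \<inter> J2. x (?a, j) = x (?b, j)}"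
  proof (intro card_mono subsetI)
    fix k assume "k \<in> align J1' J1 ` G"
    then obtain j where j: "j \<in> J1'" "j \<in> J2'" "k = align J1' J1 j" "k = align J2' J2 j"
      by (auto simp: G_def)
    have "k \<in> J1" "k \<in> J2"
      using j align_in[of J1' J1 j] align_in[of J2' J2 j] fin assms by auto
    moreover have "x (?a, k) = x (?b, k)"
      using co i j by (auto simp: coincident_def)
    ultimately show "k \<in> {j \<in> J1 \<inter> J2. x (?a, j) = x (?b, j)}"
      by simp
  qed (use fin in auto)
  finally have "\<theta> \<le> card {j \<in> J1 \<inter> J2. x (?a, j) = x (?b, j)}"
    by simp
  moreover have "?a < s" "?b < s"
    using align_in[of I1' I1 i] align_in[of I2' I2 i] i fin assms(2-4) by auto
  ultimately show False
    using assms(1) ne by (auto simp: similar_rows_def)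
qed

section \<open>Gluing the alignments of all traces\<close>

lemma strict_chain_id:
  fixes f :: "nat \<Rightarrow> nat"
  assumes step: "\<And>i. Suc i < s \<Longrightarrow> f i < f (Suc i)" and bound: "\<And>i. i < s \<Longrightarrow> f i < s"
    and "i < s"
  shows "f i = i"
proof (rule antisym)
  show "i \<le> f i"
    using \<open>i < s\<close>
  proof (induction i)
    case (Suc i)
    then show ?case using step[of i] by simp
  qed simp
  \<comment> \<open>The upper bound propagates downwards from the last index \<open>s - 1\<close>;
    \<open>k\<close> is the distance from it.\<close>
  have "f (s - Suc k) \<le> s - Suc k" if "k < s" for k
    using that
  proof (induction k)
    case 0
    then show ?case using bound[of "s - 1"] by simp
  next
    case (Suc k)
    then have "f (s - Suc (Suc k)) < f (s - Suc k)"
      using step[of "s - Suc (Suc k)"] by (simp add: Suc_diff_Suc)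
    then show ?case using Suc by simp
  qed
  from this[of "s - Suc i"] show "f i \<le> i"
    using \<open>i < s\<close> by simp
qed

text \<open>The alignments agree wherever two of them are defined, so they form one function on
  \<open>{..<s}\<close>. Strict monotonicity only has to be checked between consecutive indices, and
  some trace contains both of these.\<close>

lemma align_glue:
  assumes sub: "\<And>t. t \<in> T \<Longrightarrow> I' t \<subseteq> {..<s} \<and> I t \<subseteq> {..<s} \<and> card (I t) = card (I' t)"
    and eq: "\<And>t u i. t \<in> T \<Longrightarrow> u \<in> T \<Longrightarrow> i \<in> I' t \<Longrightarrow> i \<in> I' u \<Longrightarrow>
               align (I' t) (I t) i = align (I' u) (I u) i"
    and cover: "\<And>i. i < s \<Longrightarrow> \<exists>t\<in>T. i \<in> I' t"
    and cover2: "\<And>i. Suc i < s \<Longrightarrow> \<exists>t\<in>T. i \<in> I' t \<and> Suc i \<in> I' t"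
    and t: "t \<in> T" "i \<in> I' t"
  shows "align (I' t) (I t) i = i"
proof -
  \<comment> \<open>The trace \<open>\<tau> i\<close> is an arbitrary one in which \<open>i\<close>
    survives; by \<open>eq\<close> the choice does not affect the value.\<close>
  obtain \<tau> where \<tau>: "\<And>i. i < s \<Longrightarrow> \<tau> i \<in> T \<and> i \<in> I' (\<tau> i)"
    using cover by metis
  define f where "f i = align (I' (\<tau> i)) (I (\<tau> i)) i" for i
  have f: "align (I' t) (I t) i = f i" if "t \<in> T" "i \<in> I' t" for t i
    unfolding f_def using that \<tau>[of i] sub[of t] by (intro eq) auto
  have fin: "finite (I' t)" if "t \<in> T" for t
    using sub[OF that] finite_subset by blast
  have "f i = i"
  proof (rule strict_chain_id)
    fix i assume "Suc i < s"
    then obtain t where "t \<in> T" "i \<in> I' t" "Suc i \<in> I' t"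
      using cover2 by blast
    then show "f i < f (Suc i)"
      using align_less[of "I' t" "I t" "Suc i" i] sub[of t] fin[of t] by (simp add: f)
  next
    fix i assume "i < s"
    then show "f i < s"
      using \<tau>[of i] sub[of "\<tau> i"] align_in[of "I' (\<tau> i)" "I (\<tau> i)" i] fin[of "\<tau> i"]
      by (auto simp: f_def)
  next
    show "i < s" using sub t by blast
  qed
  with f t show ?thesis by simp
qed

section \<open>Determination of the matrix by its traces\<close>

text \<open>The tolerance \<open>1/5\<close> is small enough for \<open>(3/2) powr (6/5) < 2 powr (4/5)\<close>.\<close>
definition good :: "real \<Rightarrow> nat \<Rightarrow> (nat set \<times> nat set) list \<Rightarrow> bool" where
  "good c s IJ \<longleftrightarrow>
     set IJ \<subseteq> Pow {..<s} \<times> Pow {..<s} \<and>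
     (\<forall>t<length IJ. \<forall>u<length IJ. t \<noteq> u \<longrightarrow>
        \<bar>real (card (fst (IJ ! t) \<inter> fst (IJ ! u))) - c * s\<bar> \<le> c * s / 5 \<and>
        \<bar>real (card (snd (IJ ! t) \<inter> snd (IJ ! u))) - c * s\<bar> \<le> c * s / 5) \<and>
     (\<forall>i<s. \<forall>j<s. \<exists>(I, J) \<in> set IJ. i \<in> I \<and> j \<in> J) \<and>
     (\<forall>i<s. \<forall>j<s. \<exists>(I, J) \<in> set IJ. i \<in> I \<and> j \<in> I) \<and>
     (\<forall>i<s. \<forall>j<s. \<exists>(I, J) \<in> set IJ. i \<in> J \<and> j \<in> J)"

text \<open>Columns are treated as rows of the transpose \<open>x \<circ> prod.swap\<close>.\<close>
definition deceptive ::
  "real \<Rightarrow> nat \<Rightarrow> nat \<Rightarrow> (nat set \<times> nat set) list \<Rightarrow> (nat \<times> nat \<Rightarrow> bool) \<Rightarrow> bool" where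
  "deceptive c s K IJ x \<longleftrightarrow>
     self_similar s K (4/5 * c * s) x \<or> self_similar s K (4/5 * c * s) (x \<circ> prod.swap) \<or>
     (\<exists>t<length IJ. \<exists>u<length IJ. t \<noteq> u \<and>
        (similar_rows s (4/5 * c * s - 2 * real K) (snd (IJ ! t) \<inter> snd (IJ ! u)) x \<or>
         similar_rows s (4/5 * c * s - 2 * real K) (fst (IJ ! t) \<inter> fst (IJ ! u)) (x \<circ> prod.swap)))"

text \<open>Rows and columns support each other crosswise: a bound on misaligned columns makes the
  row alignments consistent, and a bound on misaligned rows makes the column alignments consistent.
  Gluing then yields identities in both directions, and each entry is visible in some trace.\<close>

lemma traces_determine:
  assumes good: "good c s IJ" "good c s IJ'"
    and X': "X' \<in> carrier_mat s s"
    and eq: "map (\<lambda>(I, J). submatrix (mat s s x) I J) IJ = map (\<lambda>(I, J). submatrix X' I J) IJ'"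
    and nd: "\<not> deceptive c s K IJ x"
  shows "X' = mat s s x"
proof -
  define I J I' J' where "I t = fst (IJ ! t)" and "J t = snd (IJ ! t)"
    and "I' t = fst (IJ' ! t)" and "J' t = snd (IJ' ! t)" for t
  define m where "m = length IJ"
  have len: "length IJ' = m"
    using eq m_def by (metis length_map)
  let ?y = "x \<circ> prod.swap"
  have sub: "I t \<subseteq> {..<s}" "J t \<subseteq> {..<s}" "I' t \<subseteq> {..<s}" "J' t \<subseteq> {..<s}" if "t < m" for t
  proof -
    have "IJ ! t \<in> Pow {..<s} \<times> Pow {..<s}" "IJ' ! t \<in> Pow {..<s} \<times> Pow {..<s}"
      using good that len nth_mem unfolding good_def m_def by (metis subsetD)+
    then show "I t \<subseteq> {..<s}" "J t \<subseteq> {..<s}" "I' t \<subseteq> {..<s}" "J' t \<subseteq> {..<s}"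
      by (auto simp: I_def J_def I'_def J'_def mem_Times_iff)
  qed
  have eqt: "submatrix (mat s s x) (I t) (J t) = submatrix X' (I' t) (J' t)" if "t < m" for t
    using arg_cong[OF eq, of "\<lambda>ys. ys ! t"] that len m_def
    by (simp add: I_def J_def I'_def J'_def case_prod_unfold)
  note al = submatrix_align[OF X' sub eqt]
  have co: "coincident x (I' t \<inter> I' u) (J' t \<inter> J' u)
      (I' t) (I t) (I' u) (I u) (J' t) (J t) (J' u) (J u)" if "t < m" "u < m" for t u
    using al(3)[of t] al(3)[of u] that by (auto simp: coincident_def)
  have co': "coincident ?y (J' t \<inter> J' u) (I' t \<inter> I' u)
      (J' t) (J t) (J' u) (J u) (I' t) (I t) (I' u) (I u)" if "t < m" "u < m" for t u
    using co[OF that] by (auto simp: coincident_def)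
  have big: "4/5 * c * s \<le> card (I' t \<inter> I' u)" "4/5 * c * s \<le> card (J' t \<inter> J' u)"
    if "t < m" "u < m" "t \<noteq> u" for t u
  proof -
    have "\<bar>real (card (I' t \<inter> I' u)) - c * s\<bar> \<le> c * s / 5"
      "\<bar>real (card (J' t \<inter> J' u)) - c * s\<bar> \<le> c * s / 5"
      using good(2) that len unfolding good_def I'_def J'_def by blast+
    then show "4/5 * c * s \<le> card (I' t \<inter> I' u)" "4/5 * c * s \<le> card (J' t \<inter> J' u)"
      by linarith+
  qed
  have ns: "\<not> self_similar s K (4/5 * c * s) x" "\<not> self_similar s K (4/5 * c * s) ?y"
    "\<And>t u. t < m \<Longrightarrow> u < m \<Longrightarrow> t \<noteq> u \<Longrightarrow> \<not> similar_rows s (4/5 * c * s - 2 * real K) (J t \<inter> J u) x"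
    "\<And>t u. t < m \<Longrightarrow> u < m \<Longrightarrow> t \<noteq> u \<Longrightarrow> \<not> similar_rows s (4/5 * c * s - 2 * real K) (I t \<inter> I u) ?y"
    using nd unfolding deceptive_def m_def I_def J_def by blast+
  have subs: "{I' t, I t, I' u, I u, J' t, J t, J' u, J u} \<subseteq> Pow {..<s}"
    "{J' t, J t, J' u, J u, I' t, I t, I' u, I u} \<subseteq> Pow {..<s}" if "t < m" "u < m" for t u
    using sub that by auto
  have eqI: "align (I' t) (I t) i = align (I' u) (I u) i"
    if tu: "t \<in> {..<m}" "u \<in> {..<m}" and i: "i \<in> I' t" "i \<in> I' u" for t u i
  proof (cases "t = u")
    case False
    have tu': "t < m" "u < m" using tu by auto
    \<comment> \<open>For the transposed bits the columns play the role of rows, so this count comes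
      from the second \<open>self_similar\<close> clause.\<close>
    have few: "card {j \<in> J' t \<inter> J' u. align (J' t) (J t) j \<noteq> align (J' u) (J u) j} < 2 * K"
      by (rule few_misaligned[OF ns(2) subs(2)]) (use al big co' tu' False in auto)
    show ?thesis
      by (rule align_eq[OF ns(3) subs(1) _ _ _ _ few _ co])
        (use al big(2)[of t u] tu' False i in \<open>auto simp: algebra_simps\<close>)
  qed simp
  have eqJ: "align (J' t) (J t) i = align (J' u) (J u) i"
    if tu: "t \<in> {..<m}" "u \<in> {..<m}" and i: "i \<in> J' t" "i \<in> J' u" for t u i
  proof (cases "t = u")
    case False
    have tu': "t < m" "u < m" using tu by auto
    have few: "card {j \<in> I' t \<inter> I' u. align (I' t) (I t) j \<noteq> align (I' u) (I u) j} < 2 * K"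
      by (rule few_misaligned[OF ns(1) subs(1)]) (use al big co tu' False in auto)
    show ?thesis
      by (rule align_eq[OF ns(4) subs(2) _ _ _ _ few _ co'])
        (use al big(1)[of t u] tu' False i in \<open>auto simp: algebra_simps\<close>)
  qed simp
  have set': "(A, B) \<in> set IJ' \<longleftrightarrow> (\<exists>t<m. A = I' t \<and> B = J' t)" for A B
    using len by (auto simp: in_set_conv_nth I'_def J'_def)
  have "\<exists>(A, B)\<in>set IJ'. i \<in> A \<and> j \<in> B" "\<exists>(A, B)\<in>set IJ'. i \<in> A \<and> j \<in> A"
    "\<exists>(A, B)\<in>set IJ'. i \<in> B \<and> j \<in> B" if "i < s" "j < s" for i j
    using good(2) that by (simp_all add: good_def)
  then have cov: "\<exists>t<m. i \<in> I' t \<and> j \<in> J' t" "\<exists>t<m. i \<in> I' t \<and> j \<in> I' t"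
    "\<exists>t<m. i \<in> J' t \<and> j \<in> J' t" if "i < s" "j < s" for i j
    using that unfolding Bex_def split_paired_Ex split_conv set' by metis+
  \<comment> \<open>The joint survival of \<open>i\<close> and \<open>Suc i\<close> supplies the
    consecutive comparison needed for gluing.\<close>
  have idI: "align (I' t) (I t) i = i" if "t < m" "i \<in> I' t" for t i
  proof (rule align_glue[of "{..<m}" I' s I, OF _ eqI])
    show "\<exists>t\<in>{..<m}. i \<in> I' t" if "i < s" for i
      using cov(2)[OF that that] by auto
    show "\<exists>t\<in>{..<m}. i \<in> I' t \<and> Suc i \<in> I' t" if "Suc i < s" for i
      using cov(2)[of i "Suc i"] that by auto
  qed (use sub(1,3) al(1) that in simp_all)
  have idJ: "align (J' t) (J t) i = i" if "t < m" "i \<in> J' t" for t i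
  proof (rule align_glue[of "{..<m}" J' s J, OF _ eqJ])
    show "\<exists>t\<in>{..<m}. i \<in> J' t" if "i < s" for i
      using cov(3)[OF that that] by auto
    show "\<exists>t\<in>{..<m}. i \<in> J' t \<and> Suc i \<in> J' t" if "Suc i < s" for i
      using cov(3)[of i "Suc i"] that by auto
  qed (use sub(2,4) al(2) that in simp_all)
  show ?thesis
  proof (rule eq_matI)
    fix i j assume ij: "i < dim_row (mat s s x)" "j < dim_col (mat s s x)"
    then obtain t where "t < m" "i \<in> I' t" "j \<in> J' t"
      using cov(1) by auto
    then show "X' $$ (i, j) = mat s s x $$ (i, j)"
      using al(3) idI idJ ij by simp
  qed (use X' in auto)
qed


section \<open>Products of discrete distributions\<close>

abbreviation fair_bits :: "'a set \<Rightarrow> ('a \<Rightarrow> bool) pmf" where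
  "fair_bits A \<equiv> Pi_pmf A False (\<lambda>_. bernoulli_pmf (1 / 2))"

lemma fair_bits_eq_pmf_of_set:
  assumes "finite A"
  shows "fair_bits A = pmf_of_set (PiE_dflt A False (\<lambda>_. UNIV))"
  using assms by (subst Pi_pmf_of_set[symmetric]) (simp_all add: bernoulli_pmf_half_conv_pmf_of_set)

lemma card_bits:
  assumes "finite A"
  shows "card (PiE_dflt A False (\<lambda>_. UNIV :: bool set)) = 2 ^ card A"
  using assms by (subst card_PiE_dflt) simp_all

text \<open>The equations are triangular with respect to \<open>rank\<close>: the bits outside \<open>f ` B\<close> determine the rest.\<close>
lemma prob_fair_bits_equal_pairs:
  fixes rank :: "'a \<Rightarrow> nat"
  assumes A: "finite A" "f ` B \<subseteq> A" "g ` B \<subseteq> A" and inj: "inj_on f B"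
    and rank: "\<And>e. e \<in> B \<Longrightarrow> rank (g e) < rank (f e)"
  shows "measure_pmf.prob (fair_bits A) {x. \<forall>e\<in>B. x (f e) = x (g e)} \<le> (1 / 2) ^ card B"
proof -
  let ?S = "PiE_dflt A False (\<lambda>_. UNIV :: bool set)"
  let ?S' = "PiE_dflt (A - f ` B) False (\<lambda>_. UNIV :: bool set)"
  let ?E = "{x. \<forall>e\<in>B. x (f e) = x (g e)}"
  have fin: "finite ?S" "finite ?S'" and ne: "?S \<noteq> {}"
    using A by auto
  have "inj_on (\<lambda>x a. if a \<in> f ` B then False else x a) (?S \<inter> ?E)"
  proof (rule inj_onI)
    fix x y assume x: "x \<in> ?S \<inter> ?E" and y: "y \<in> ?S \<inter> ?E"
      and eq: "(\<lambda>a. if a \<in> f ` B then False else x a) = (\<lambda>a. if a \<in> f ` B then False else y a)"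
    have "x a = y a" for a
    \<comment> \<open>An erased bit at \<open>f e\<close> equals the bit at \<open>g e\<close>,
      which has smaller rank and is already recovered.\<close>
    proof (induction "rank a" arbitrary: a rule: less_induct)
      case less
      show ?case
      proof (cases "a \<in> f ` B")
        case True
        then obtain e where e: "e \<in> B" "a = f e" by blast
        then have "x (g e) = y (g e)" using rank less by blast
        then show ?thesis using x y e by simp
      next
        case False
        then show ?thesis using fun_cong[OF eq, of a] by simp
      qed
    qed
    then show "x = y" by blast
  qed
  moreover have "(\<lambda>x a. if a \<in> f ` B then False else x a) ` (?S \<inter> ?E) \<subseteq> ?S'"
    by (auto simp: PiE_dflt_def)
  ultimately have "card (?S \<inter> ?E) \<le> card ?S'"
    using fin(2) by (rule card_inj_on_le)
  also have "\<dots> = 2 ^ (card A - card B)"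
    using A inj by (subst card_bits) (simp_all add: card_Diff_subset card_image finite_subset)
  finally have "card (?S \<inter> ?E) \<le> 2 ^ (card A - card B)" .
  then have "real (card (?S \<inter> ?E)) \<le> 2 ^ (card A - card B)"
    using of_nat_mono[where 'a = real] by fastforce
  moreover have "card B \<le> card A"
    using A inj by (metis card_image card_mono)
  ultimately show ?thesis
    unfolding fair_bits_eq_pmf_of_set[OF A(1)] measure_pmf_of_set[OF ne fin(1)] card_bits[OF A(1)]
    by (simp add: divide_le_eq power_diff power_one_over)
qed

lemma sum_Pow_power_card:
  fixes r :: "'b :: comm_semiring_1"
  assumes "finite D"
  shows "(\<Sum>S\<in>Pow D. r ^ card S) = (1 + r) ^ card D"
  using prod_add[OF assms, of "\<lambda>_. r" "\<lambda>_. 1"] by (simp add: add.commute)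

text \<open>Markov's inequality for \<open>2 ^ card N\<close>, the number of subsets of \<open>N\<close>.\<close>
lemma prob_card_ge_le:
  fixes N :: "'a \<Rightarrow> 'b set"
  assumes D: "finite D" "\<And>x. N x \<subseteq> D"
    and prob: "\<And>S. S \<subseteq> D \<Longrightarrow> measure_pmf.prob M {x. S \<subseteq> N x} \<le> (1 / 2) ^ card S"
  shows "measure_pmf.prob M {x. \<theta> \<le> real (card (N x))} \<le> (3 / 2) ^ card D / 2 powr \<theta>"
proof -
  have fin: "finite (N x)" for x
    using D finite_subset by blast
  have pow: "2 ^ card (N x) = (\<Sum>S\<in>Pow D. indicat_real {x. S \<subseteq> N x} x)" for x
  proof -
    have "(\<Sum>S\<in>Pow D. indicat_real {x. S \<subseteq> N x} x) = (\<Sum>S\<in>Pow (N x). 1)"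
      using D by (intro sum.mono_neutral_cong_right) (auto simp: indicator_def)
    then show ?thesis by (simp add: card_Pow fin)
  qed
  have "measure_pmf.prob M {x. \<theta> \<le> real (card (N x))}
      \<le> measure_pmf.prob M {x \<in> space M. 2 powr \<theta> \<le> 2 ^ card (N x)}"
    by (intro measure_pmf.finite_measure_mono) (auto simp flip: powr_realpow)
  also have "\<dots> \<le> measure_pmf.expectation M (\<lambda>x. 2 ^ card (N x)) / 2 powr \<theta>"
    unfolding pow by (intro integral_Markov_inequality_measure[of _ _ "{}"])
      (auto intro!: sum_nonneg Bochner_Integration.integrable_sum
        measure_pmf.integrable_const_bound[where B = 1])
  also have "measure_pmf.expectation M (\<lambda>x. 2 ^ card (N x))
      = (\<Sum>S\<in>Pow D. measure_pmf.prob M {x. S \<subseteq> N x})"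
    unfolding pow by (subst Bochner_Integration.integral_sum)
      (auto intro!: measure_pmf.integrable_const_bound[where B = 1])
  also have "\<dots> \<le> (\<Sum>S\<in>Pow D. (1 / 2) ^ card S)"
    by (intro sum_mono prob) auto
  also have "\<dots> = (3 / 2) ^ card D"
    by (simp add: sum_Pow_power_card[OF D(1)])
  finally show ?thesis by (simp add: divide_right_mono)
qed

text \<open>Integrating over the second component conditions on \<open>b\<close>: where
  \<open>P b\<close> fails the section is empty, elsewhere it has probability at most
  \<open>e\<close>.\<close>

lemma prob_pair_pmf_le:
  assumes "\<And>b. P b \<Longrightarrow> measure_pmf.prob M {a. Q a b} \<le> e" "0 \<le> e"
  shows "measure_pmf.prob (pair_pmf M N) {(a, b). P b \<and> Q a b} \<le> e"
proof -
  have "emeasure (pair_pmf M N) {(a, b). P b \<and> Q a b}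
      = (\<integral>\<^sup>+b. emeasure M {a. P b \<and> Q a b} \<partial>N)"
    by (subst pair_commute_pmf)
      (simp add: pair_pmf_def map_pmf_def bind_assoc_pmf bind_return_pmf nn_integral_pmf'
         flip: nn_integral_indicator, simp add: indicator_def)
  also have "\<dots> \<le> (\<integral>\<^sup>+b. ennreal e \<partial>N)"
  proof (rule nn_integral_mono)
    fix b show "emeasure M {a. P b \<and> Q a b} \<le> ennreal e"
      using assms by (cases "P b") (auto simp: measure_pmf.emeasure_eq_measure intro!: ennreal_leI)
  qed
  also have "\<dots> = ennreal e"
    by simp
  finally show ?thesis
    using assms(2) by (simp add: measure_pmf.emeasure_eq_measure)
qed

lemma prob_pair_pmf_Times:
  "measure_pmf.prob (pair_pmf M N) (A \<times> B) = measure_pmf.prob M A * measure_pmf.prob N B"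
proof -
  \<comment> \<open>Restriction to the supports makes both factors countable, as the product rule
    requires.\<close>
  have "measure_pmf.prob (pair_pmf M N) (A \<times> B)
      = measure_pmf.prob (pair_pmf M N) ((A \<inter> set_pmf M) \<times> (B \<inter> set_pmf N))"
    by (rule measure_prob_cong_0) (auto simp: set_pmf_eq pmf_pair)
  also have "\<dots> = measure_pmf.prob M (A \<inter> set_pmf M) * measure_pmf.prob N (B \<inter> set_pmf N)"
    by (intro measure_pmf_prob_product) (auto intro: countable_subset)
  finally show ?thesis
    by (simp add: measure_Int_set_pmf)
qed

section \<open>Independent replications\<close>

lemma replicate_pmf_Suc_eq:
  "replicate_pmf (Suc n) p = map_pmf (\<lambda>(x, xs). x # xs) (pair_pmf p (replicate_pmf n p))"
  by (simp add: pair_pmf_def map_pmf_def bind_assoc_pmf bind_return_pmf)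

lemma prob_replicate_pmf_all:
  "measure_pmf.prob (replicate_pmf m p) {xs. set xs \<subseteq> A} = measure_pmf.prob p A ^ m"
proof (induction m)
  case (Suc m)
  have "(\<lambda>(x, xs). x # xs) -` {xs. set xs \<subseteq> A} = A \<times> {xs. set xs \<subseteq> A}"
    by auto
  then show ?case
    by (simp only: replicate_pmf_Suc_eq measure_map_pmf prob_pair_pmf_Times Suc power_Suc)
qed simp

lemma map_nth_replicate_pmf:
  assumes "t < m"
  shows "map_pmf (\<lambda>xs. xs ! t) (replicate_pmf m p) = p"
  using assms
proof (induction m arbitrary: t)
  case (Suc m)
  have "map_pmf (\<lambda>xs. xs ! t) (replicate_pmf (Suc m) p)
      = map_pmf (\<lambda>(x, xs). case t of 0 \<Rightarrow> x | Suc t' \<Rightarrow> xs ! t') (pair_pmf p (replicate_pmf m p))"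
    unfolding replicate_pmf_Suc_eq pmf.map_comp
    by (intro map_pmf_cong) (auto split: nat.splits)
  also have "\<dots> = p"
  proof (cases t)
    case 0
    have "map_pmf (\<lambda>(x, xs). x) (pair_pmf p (replicate_pmf m p))
        = map_pmf fst (pair_pmf p (replicate_pmf m p))"
      by (intro map_pmf_cong) auto
    with 0 show ?thesis by (simp add: map_fst_pair_pmf)
  next
    case (Suc t')
    have "map_pmf (\<lambda>(x, xs). xs ! t') (pair_pmf p (replicate_pmf m p))
        = map_pmf (\<lambda>xs. xs ! t') (map_pmf snd (pair_pmf p (replicate_pmf m p)))"
      by (simp only: pmf.map_comp o_def case_prod_unfold)
    with Suc Suc.prems Suc.IH[of t'] show ?thesis by (simp add: map_snd_pair_pmf)
  qed
  finally show ?case .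
qed simp

text \<open>Pairwise independence of the traces is what the overlap estimate uses. In the induction
  either one index is the head, leaving a single marginal, or both lie in the tail.\<close>

lemma map_nth_nth_replicate_pmf:
  assumes "t < m" "u < m" "t \<noteq> u"
  shows "map_pmf (\<lambda>xs. (xs ! t, xs ! u)) (replicate_pmf m p) = pair_pmf p p"
  using assms
proof (induction m arbitrary: t u)
  case (Suc m)
  let ?R = "pair_pmf p (replicate_pmf m p)"
  have *: "map_pmf (\<lambda>xs. (xs ! t, xs ! u)) (replicate_pmf (Suc m) p)
      = map_pmf (\<lambda>(x, xs). ((x # xs) ! t, (x # xs) ! u)) ?R"
    unfolding replicate_pmf_Suc_eq pmf.map_comp by (intro map_pmf_cong) auto
  consider u' where "t = 0" "u = Suc u'" | t' where "u = 0" "t = Suc t'"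
    | t' u' where "t = Suc t'" "u = Suc u'"
    using Suc.prems by (metis not0_implies_Suc)
  then show ?case
  proof cases
    case 1
    have "map_pmf (\<lambda>(x, xs). (x, xs ! u')) ?R = pair_pmf p (map_pmf (\<lambda>xs. xs ! u') (replicate_pmf m p))"
      by (simp add: pair_map_pmf2 apsnd_def map_prod_def)
    then show ?thesis using 1 Suc.prems * by (simp add: map_nth_replicate_pmf)
  next
    case 2
    have "map_pmf (\<lambda>(x, xs). (xs ! t', x)) ?R
        = map_pmf (\<lambda>(x, y). (y, x)) (pair_pmf p (map_pmf (\<lambda>xs. xs ! t') (replicate_pmf m p)))"
      by (simp add: pair_map_pmf2 apsnd_def map_prod_def pmf.map_comp o_def case_prod_unfold)
    also have "\<dots> = pair_pmf p p"
      using 2 Suc.prems by (simp add: map_nth_replicate_pmf flip: pair_commute_pmf)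
    finally show ?thesis using 2 * by simp
  next
    case 3
    have "map_pmf (\<lambda>(x, xs). (xs ! t', xs ! u')) ?R
        = map_pmf (\<lambda>xs. (xs ! t', xs ! u')) (map_pmf snd ?R)"
      by (simp only: pmf.map_comp o_def case_prod_unfold)
    then show ?thesis using 3 Suc.prems Suc.IH[of t' u'] * by (simp add: map_snd_pair_pmf)
  qed
qed simp

section \<open>Survivor sets and their intersections\<close>

lemma bernoulli_pmf_conj:
  assumes "a \<in> {0..1}" "b \<in> {0..1}"
  shows "do {x \<leftarrow> bernoulli_pmf a; y \<leftarrow> bernoulli_pmf b; return_pmf (x \<and> y)} = bernoulli_pmf (a * b)"
proof (rule pmf_eqI)
  fix i
  have "a * b \<in> {0..1}"
    using assms by (auto intro: mult_le_one)
  then show "pmf (do {x \<leftarrow> bernoulli_pmf a; y \<leftarrow> bernoulli_pmf b; return_pmf (x \<and> y)}) i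
      = pmf (bernoulli_pmf (a * b)) i"
    using assms by (cases i) (simp_all add: pmf_bind measure_pmf_single algebra_simps)
qed

lemma Pi_pmf_bernoulli_conj:
  assumes "finite A" "a \<in> {0..1}" "b \<in> {0..1}"
  shows "map_pmf (\<lambda>(f, g) x. x \<in> A \<and> f x \<and> g x)
           (pair_pmf (Pi_pmf A False (\<lambda>_. bernoulli_pmf a)) (Pi_pmf A False (\<lambda>_. bernoulli_pmf b)))
         = Pi_pmf A False (\<lambda>_. bernoulli_pmf (a * b))"
proof -
  have "Pi_pmf A False (\<lambda>_. bernoulli_pmf (a * b))
     = Pi_pmf A False (\<lambda>_. bernoulli_pmf a \<bind> (\<lambda>x. bernoulli_pmf b \<bind> (\<lambda>y. return_pmf (x \<and> y))))"
    using assms by (simp only: bernoulli_pmf_conj)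
  also have "\<dots> = Pi_pmf A False (\<lambda>_. bernoulli_pmf a) \<bind> (\<lambda>f.
      Pi_pmf A False (\<lambda>_. bernoulli_pmf b) \<bind> (\<lambda>g. return_pmf (\<lambda>x. if x \<in> A then f x \<and> g x else False)))"
    using assms(1) by (simp only: Pi_pmf_bind[where d' = False] Pi_pmf_return_pmf)
  also have "\<dots> = Pi_pmf A False (\<lambda>_. bernoulli_pmf a) \<bind> (\<lambda>f.
      Pi_pmf A False (\<lambda>_. bernoulli_pmf b) \<bind> (\<lambda>g. return_pmf (\<lambda>x. x \<in> A \<and> f x \<and> g x)))"
    by (intro bind_pmf_cong refl arg_cong[where f = return_pmf] ext) auto
  also have "\<dots>
     = map_pmf (\<lambda>(f, g) x. x \<in> A \<and> f x \<and> g x)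
           (pair_pmf (Pi_pmf A False (\<lambda>_. bernoulli_pmf a)) (Pi_pmf A False (\<lambda>_. bernoulli_pmf b)))"
    by (simp add: pair_pmf_def map_pmf_def bind_assoc_pmf bind_return_pmf)
  finally show ?thesis ..
qed

lemma survivors_subset: "I \<in> set_pmf (survivors p k) \<Longrightarrow> I \<subseteq> {..<k}"
  unfolding survivors_def using set_Pi_pmf_subset[of "{..<k}" False] by fastforce

text \<open>Each index survives in both sets with probability \<open>(1 - p)\<^sup>2\<close>,
  independently of the others, so the common survivors are counted by a binomial variable.\<close>

lemma card_survivors_Int:
  assumes "0 \<le> p" "p \<le> 1"
  shows "map_pmf (\<lambda>(I, J). card (I \<inter> J)) (pair_pmf (survivors p k) (survivors p k))
           = binomial_pmf k ((1 - p)\<^sup>2)"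
proof -
  let ?P = "Pi_pmf {..<k} False (\<lambda>_. bernoulli_pmf (1 - p))"
  have "map_pmf (\<lambda>(I, J). card (I \<inter> J)) (pair_pmf (survivors p k) (survivors p k))
      = map_pmf (\<lambda>(f, g). card (Collect f \<inter> Collect g)) (pair_pmf ?P ?P)"
    by (simp add: survivors_def map_pair[symmetric] pmf.map_comp o_def case_prod_unfold)
  also have "\<dots> = map_pmf (\<lambda>(f, g). card {x \<in> {..<k}. x \<in> {..<k} \<and> f x \<and> g x}) (pair_pmf ?P ?P)"
    using set_Pi_pmf_subset[of "{..<k}" False "\<lambda>_. bernoulli_pmf (1 - p)"]
    by (intro map_pmf_cong) (fastforce intro: arg_cong[where f = card])+
  also have "\<dots> = map_pmf (\<lambda>f. card {x \<in> {..<k}. f x})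
      (map_pmf (\<lambda>(f, g) x. x \<in> {..<k} \<and> f x \<and> g x) (pair_pmf ?P ?P))"
    by (simp add: pmf.map_comp o_def case_prod_unfold)
  also have "\<dots> = binomial_pmf k ((1 - p)\<^sup>2)"
    using assms
    by (subst Pi_pmf_bernoulli_conj)
      (auto simp: power2_eq_square mult_le_one binomial_pmf_altdef'[of "{..<k}" k _ False])
  finally show ?thesis .
qed

lemma prob_survivors_superset:
  assumes "0 \<le> p" "p \<le> 1" "S \<subseteq> {..<k}"
  shows "measure_pmf.prob (survivors p k) {I. S \<subseteq> I} = (1 - p) ^ card S"
proof -
  let ?B = "\<lambda>i. if i \<in> S then {True} else UNIV"
  have "{f. S \<subseteq> Collect f} = Pi {..<k} ?B"
    using assms(3) by (auto simp: Pi_def)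
  then have "measure_pmf.prob (survivors p k) {I. S \<subseteq> I}
      = (\<Prod>i<k. measure_pmf.prob (bernoulli_pmf (1 - p)) (?B i))"
    by (simp add: survivors_def measure_Pi_pmf_Pi vimage_def)
  also have "\<dots> = (\<Prod>i<k. if i \<in> S then 1 - p else 1)"
    using assms by (intro prod.cong) (auto simp: measure_pmf_single)
  also have "\<dots> = (1 - p) ^ card S"
    using assms(3) by (simp add: prod.If_cases Int_absorb1)
  finally show ?thesis .
qed


section \<open>Error probabilities\<close>

lemma prob_UN_le:
  fixes e :: real
  assumes "finite I" "\<And>i. i \<in> I \<Longrightarrow> measure_pmf.prob M (A i) \<le> e"
  shows "measure_pmf.prob M (\<Union>i\<in>I. A i) \<le> card I * e"
proof -
  have "measure_pmf.prob M (\<Union>i\<in>I. A i) \<le> (\<Sum>i\<in>I. measure_pmf.prob M (A i))"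
    using assms(1) by (intro measure_pmf.finite_measure_subadditive_finite) auto
  also have "\<dots> \<le> card I * e"
    using assms(2) by (rule sum_bounded_above)
  finally show ?thesis .
qed

lemma prob_Un_le:
  assumes "measure_pmf.prob M A \<le> a" "measure_pmf.prob M B \<le> b"
  shows "measure_pmf.prob M (A \<union> B) \<le> a + b"
  using measure_Un_le[of A "measure_pmf M" B] assms by simp

lemma finite_distinct_pairs: "finite {(t, u). t < m \<and> u < m \<and> t \<noteq> (u :: nat)}"
  by (rule finite_subset[of _ "{..<m} \<times> {..<m}"]) auto

lemma card_distinct_pairs_le: "real (card {(t, u). t < m \<and> u < m \<and> t \<noteq> (u :: nat)}) \<le> real m ^ 2"
proof -
  have "card {(t, u). t < m \<and> u < m \<and> t \<noteq> u} \<le> card ({..<m} \<times> {..<m})"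
    by (rule card_mono) auto
  then show ?thesis
    using of_nat_mono[where 'a = real] by (fastforce simp: power2_eq_square)
qed

section \<open>Coincidences in a random matrix are unlikely\<close>

lemma prob_similar_rows:
  assumes "D \<subseteq> {..<s}"
  shows "measure_pmf.prob (fair_bits ({..<s} \<times> {..<s})) {x. similar_rows s \<theta> D x}
           \<le> real s ^ 2 * ((3 / 2) ^ card D / 2 powr \<theta>)"
proof -
  let ?U = "fair_bits ({..<s} \<times> {..<s})" and ?P = "{(a, b). a < s \<and> b < s \<and> a \<noteq> b}"
  let ?A = "\<lambda>(a, b). {x. \<theta> \<le> real (card {j \<in> D. x (a, j) = x (b, j)})}"
  let ?e = "(3 / 2) ^ card D / 2 powr \<theta>"
  have fin: "finite D" using assms finite_subset by blast
  have "measure_pmf.prob ?U (\<Union>ab\<in>?P. ?A ab) \<le> card ?P * ?e"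
  proof (rule prob_UN_le)
    show "finite ?P" by (rule finite_distinct_pairs)
    fix ab assume "ab \<in> ?P"
    then obtain a b where ab: "ab = (a, b)" "a < s" "b < s" "a \<noteq> b" by auto
    have "measure_pmf.prob ?U {x. \<theta> \<le> real (card {j \<in> D. x (a, j) = x (b, j)})} \<le> ?e"
    proof (rule prob_card_ge_le)
      fix S assume S: "S \<subseteq> D"
      \<comment> \<open>The equations are oriented from the larger to the smaller row index, so that
        the row number serves as the rank.\<close>
      have "measure_pmf.prob ?U {x. \<forall>j\<in>S. x (max a b, j) = x (min a b, j)} \<le> (1 / 2) ^ card S"
        by (rule prob_fair_bits_equal_pairs[where rank = fst])
          (use S assms ab in \<open>auto simp: inj_on_def max_def min_def\<close>)
      also have "{x. \<forall>j\<in>S. x (max a b, j) = x (min a b, j)}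
          = {x. S \<subseteq> {j \<in> D. x (a, j) = x (b, j)}}"
        using S by (auto simp: max_def min_def split: if_splits)
      finally show "measure_pmf.prob ?U {x. S \<subseteq> {j \<in> D. x (a, j) = x (b, j)}} \<le> (1 / 2) ^ card S" .
    qed (use fin in auto)
    then show "measure_pmf.prob ?U (?A ab) \<le> ?e"
      using ab by simp
  qed
  also have "card ?P * ?e \<le> real s ^ 2 * ?e"
    by (intro mult_right_mono card_distinct_pairs_le) simp
  also have "(\<Union>ab\<in>?P. ?A ab) = {x. similar_rows s \<theta> D x}"
    by (auto simp: similar_rows_def)
  finally show ?thesis .
qed

text \<open>Misalignment puts the second trace's position in a strictly later row. With the row
  number as rank the equations are triangular, and there are at least \<open>K * L\<close> of
  them.\<close>

lemma prob_coincident: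
  fixes L :: real
  assumes sub: "{I1', I1, I2', I2, J1', J1, J2', J2} \<subseteq> Pow {..<s}"
    and card: "card I1 = card I1'" "card I2 = card I2'" "card J1 = card J1'" "card J2 = card J2'"
    and K: "K \<le> card (misaligned I1' I1 I2' I2)" and L: "0 \<le> L" "L \<le> card (J1' \<inter> J2')"
  shows "measure_pmf.prob (fair_bits ({..<s} \<times> {..<s}))
      {x. coincident x (misaligned I1' I1 I2' I2) (J1' \<inter> J2') I1' I1 I2' I2 J1' J1 J2' J2}
      \<le> 2 powr (- (real K * L))"
proof -
  have fin: "finite I1'" "finite I2'" "finite J1'" "finite J2'"
    using sub by (auto intro: finite_subset)
  have less: "align I1' I1 i < s" if "i \<in> I1'" for i
    using align_in[OF fin(1) card(1) that] sub by auto
  have less2: "align I2' I2 i < s" if "i \<in> I2'" for i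
    using align_in[OF fin(2) card(2) that] sub by auto
  have less3: "align J1' J1 i < s" if "i \<in> J1'" for i
    using align_in[OF fin(3) card(3) that] sub by auto
  have less4: "align J2' J2 i < s" if "i \<in> J2'" for i
    using align_in[OF fin(4) card(4) that] sub by auto
  let ?B = "misaligned I1' I1 I2' I2 \<times> (J1' \<inter> J2')"
  let ?f = "map_prod (align I2' I2) (align J2' J2)" and ?g = "map_prod (align I1' I1) (align J1' J1)"
  have "measure_pmf.prob (fair_bits ({..<s} \<times> {..<s})) {x. \<forall>e\<in>?B. x (?f e) = x (?g e)}
      \<le> (1 / 2) ^ card ?B"
  proof (rule prob_fair_bits_equal_pairs[where rank = fst])
    show "inj_on ?f ?B"
      by (rule map_prod_inj_on) (rule inj_on_subset[OF align_inj],
          use fin card in \<open>auto simp: misaligned_def\<close>)+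
  qed (auto simp: misaligned_def intro: less less2 less3 less4)
  also have "{x. \<forall>e\<in>?B. x (?f e) = x (?g e)}
      = {x. coincident x (misaligned I1' I1 I2' I2) (J1' \<inter> J2') I1' I1 I2' I2 J1' J1 J2' J2}"
    by (auto simp: coincident_def)
  also have "(1 / 2 :: real) ^ card ?B = 2 powr (- real (card ?B))"
    by (simp add: powr_minus powr_realpow power_one_over inverse_eq_divide)
  also have "\<dots> \<le> 2 powr (- (real K * L))"
    using mult_mono[of "real K" "card (misaligned I1' I1 I2' I2)" L "card (J1' \<inter> J2')"] K L
    by (simp add: card_cartesian_product)
  finally show ?thesis .
qed

text \<open>The summand \<open>8 * real s\<close> is the entropy of eight arbitrary subsets of
  \<open>{..<s}\<close>; the union bound succeeds once \<open>K * L\<close> exceeds it.\<close>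

lemma prob_self_similar:
  assumes L: "0 \<le> L"
  shows "measure_pmf.prob (fair_bits ({..<s} \<times> {..<s})) {x. self_similar s K L x}
           \<le> 2 powr (8 * real s - K * L)"
proof -
  let ?U = "fair_bits ({..<s} \<times> {..<s})" and ?P = "Pow {..<s}"
  let ?Q = "?P \<times> ?P \<times> ?P \<times> ?P \<times> ?P \<times> ?P \<times> ?P \<times> ?P"
  let ?A = "\<lambda>(I1', I1, I2', I2, J1', J1, J2', J2). {x. card I1 = card I1' \<and> card I2 = card I2' \<and>
    card J1 = card J1' \<and> card J2 = card J2' \<and> K \<le> card (misaligned I1' I1 I2' I2) \<and>
    L \<le> card (J1' \<inter> J2') \<and>
    coincident x (misaligned I1' I1 I2' I2) (J1' \<inter> J2') I1' I1 I2' I2 J1' J1 J2' J2}"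
  have "{x. self_similar s K L x} \<subseteq> (\<Union>q\<in>?Q. ?A q)"
  proof
    fix x assume "x \<in> {x. self_similar s K L x}"
    then obtain I1' I1 I2' I2 J1' J1 J2' J2
      where q: "{I1', I1, I2', I2, J1', J1, J2', J2} \<subseteq> Pow {..<s}"
        and x: "x \<in> ?A (I1', I1, I2', I2, J1', J1, J2', J2)"
      unfolding self_similar_def mem_Collect_eq split_conv by metis
    from q have "(I1', I1, I2', I2, J1', J1, J2', J2) \<in> ?Q"
      by simp
    with x show "x \<in> (\<Union>q\<in>?Q. ?A q)"
      by (rule UN_I[rotated])
  qed
  then have "measure_pmf.prob ?U {x. self_similar s K L x} \<le> measure_pmf.prob ?U (\<Union>q\<in>?Q. ?A q)"
    by (intro measure_pmf.finite_measure_mono) auto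
  also have "\<dots> \<le> card ?Q * 2 powr (- (real K * L))"
  proof (rule prob_UN_le)
    fix q assume "q \<in> ?Q"
    then obtain I1' I1 I2' I2 J1' J1 J2' J2
      where q: "q = (I1', I1, I2', I2, J1', J1, J2', J2)"
        and sub: "{I1', I1, I2', I2, J1', J1, J2', J2} \<subseteq> Pow {..<s}"
      by auto
    let ?C = "card I1 = card I1' \<and> card I2 = card I2' \<and>
      card J1 = card J1' \<and> card J2 = card J2' \<and> K \<le> card (misaligned I1' I1 I2' I2) \<and>
      L \<le> card (J1' \<inter> J2')"
    show "measure_pmf.prob ?U (?A q) \<le> 2 powr (- (real K * L))"
    proof (cases ?C)
      case True
      then show ?thesis
        unfolding q using prob_coincident[OF sub _ _ _ _ _ L] by simp
    next
      case False
      then have "?A q = {}" unfolding q by auto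
      then show ?thesis by simp
    qed
  qed simp
  also have "real (card ?Q) = 2 powr (8 * real s)"
    by (simp add: card_cartesian_product card_Pow powr_realpow[symmetric] flip: powr_add)
  also have "2 powr (8 * real s) * 2 powr (- (real K * L)) = 2 powr (8 * real s - K * L)"
    by (simp add: powr_diff powr_minus divide_simps)
  finally show ?thesis by simp
qed

text \<open>Transposition permutes the positions of independent, identically distributed bits, so it
  preserves their law.\<close>

lemma prob_fair_bits_swap:
  fixes s :: nat
  shows "measure_pmf.prob (fair_bits ({..<s} \<times> {..<s})) {x. Q (x \<circ> prod.swap)}
     = measure_pmf.prob (fair_bits ({..<s} \<times> {..<s})) {x. Q x}"
proof -
  let ?G = "{..<s} \<times> {..<s}"
  have "fair_bits ?G = map_pmf (\<lambda>x. x \<circ> prod.swap) (fair_bits ?G)"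
    by (rule Pi_pmf_bij_betw) (auto simp: bij_betw_def)
  then have "measure_pmf.prob (fair_bits ?G) {x. Q x}
      = measure_pmf.prob (map_pmf (\<lambda>x. x \<circ> prod.swap) (fair_bits ?G)) {x. Q x}"
    by (rule arg_cong)
  then show ?thesis by (simp add: vimage_def)
qed

text \<open>Here the true survivor sets are fixed and only the bits are random. The upper tolerance
  in \<open>good\<close> bounds each intersection by \<open>6/5 * c * s\<close>, which gives the
  base \<open>3 / 2\<close> its exponent.\<close>

lemma prob_deceptive:
  assumes "good c s IJ" "0 \<le> c"
  shows "measure_pmf.prob (fair_bits ({..<s} \<times> {..<s})) {x. deceptive c s K IJ x}
    \<le> 2 * 2 powr (8 * real s - K * (4/5 * c * s)) +
       real (length IJ) ^ 2 * (2 * (real s ^ 2 *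
         ((3 / 2) powr (6/5 * c * s) / 2 powr (4/5 * c * s - 2 * real K))))"
proof -
  let ?U = "fair_bits ({..<s} \<times> {..<s})" and ?m = "length IJ"
  let ?\<theta> = "4/5 * c * s - 2 * real K"
  let ?P = "{(t, u). t < ?m \<and> u < ?m \<and> t \<noteq> u}"
  let ?A = "\<lambda>(t, u). {x. similar_rows s ?\<theta> (snd (IJ ! t) \<inter> snd (IJ ! u)) x} \<union>
    {x. similar_rows s ?\<theta> (fst (IJ ! t) \<inter> fst (IJ ! u)) (x \<circ> prod.swap)}"
  let ?e = "real s ^ 2 * ((3 / 2) powr (6/5 * c * s) / 2 powr ?\<theta>)"
  have rows: "measure_pmf.prob ?U {x. similar_rows s ?\<theta> D x} \<le> ?e"
    if "D \<subseteq> {..<s}" "\<bar>real (card D) - c * s\<bar> \<le> c * s / 5" for D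
  proof -
    have "measure_pmf.prob ?U {x. similar_rows s ?\<theta> D x}
        \<le> real s ^ 2 * ((3 / 2) powr card D / 2 powr ?\<theta>)"
      using prob_similar_rows[OF that(1), of ?\<theta>] by (simp add: powr_realpow)
    also have "\<dots> \<le> ?e"
    proof (intro mult_left_mono divide_right_mono powr_mono)
      show "real (card D) \<le> 6/5 * c * s"
        using that(2) by linarith
    qed simp_all
    finally show ?thesis .
  qed
  have "measure_pmf.prob ?U (\<Union>tu\<in>?P. ?A tu) \<le> card ?P * (2 * ?e)"
  proof (rule prob_UN_le)
    show "finite ?P" by (rule finite_distinct_pairs)
    fix tu assume "tu \<in> ?P"
    then obtain t u where tu: "tu = (t, u)" "t < ?m" "u < ?m" "t \<noteq> u" by auto
    have "IJ ! t \<in> Pow {..<s} \<times> Pow {..<s}"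
      using assms(1) nth_mem[OF tu(2)] unfolding good_def by (metis subsetD)
    then have "fst (IJ ! t) \<subseteq> {..<s}" "snd (IJ ! t) \<subseteq> {..<s}"
      by auto
    moreover have "\<bar>real (card (fst (IJ ! t) \<inter> fst (IJ ! u))) - c * s\<bar> \<le> c * s / 5"
      "\<bar>real (card (snd (IJ ! t) \<inter> snd (IJ ! u))) - c * s\<bar> \<le> c * s / 5"
      using assms(1) tu by (simp_all add: good_def)
    ultimately have
      "measure_pmf.prob ?U {x. similar_rows s ?\<theta> (snd (IJ ! t) \<inter> snd (IJ ! u)) x} \<le> ?e"
      "measure_pmf.prob ?U {x. similar_rows s ?\<theta> (fst (IJ ! t) \<inter> fst (IJ ! u)) (x \<circ> prod.swap)} \<le> ?e"
      using prob_fair_bits_swap[of s "similar_rows s ?\<theta> (fst (IJ ! t) \<inter> fst (IJ ! u))"]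
        rows[of "snd (IJ ! t) \<inter> snd (IJ ! u)"] rows[of "fst (IJ ! t) \<inter> fst (IJ ! u)"]
      by (simp_all add: le_infI1)
    from prob_Un_le[OF this] show "measure_pmf.prob ?U (?A tu) \<le> 2 * ?e"
      by (simp add: tu)
  qed
  also have "card ?P * (2 * ?e) \<le> real ?m ^ 2 * (2 * ?e)"
    by (intro mult_right_mono card_distinct_pairs_le) simp
  finally have 1: "measure_pmf.prob ?U (\<Union>tu\<in>?P. ?A tu) \<le> real ?m ^ 2 * (2 * ?e)" .
  let ?L = "4/5 * c * s"
  have 2: "measure_pmf.prob ?U {x. self_similar s K ?L x} \<le> 2 powr (8 * real s - K * ?L)"
    using assms(2) prob_self_similar[of ?L s K] by simp
  then have 3: "measure_pmf.prob ?U {x. self_similar s K ?L (x \<circ> prod.swap)} \<le> 2 powr (8 * real s - K * ?L)"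
    by (subst prob_fair_bits_swap[of s "self_similar s K ?L"])
  have "{x. deceptive c s K IJ x} = {x. self_similar s K ?L x} \<union>
      {x. self_similar s K ?L (x \<circ> prod.swap)} \<union> (\<Union>tu\<in>?P. ?A tu)"
    unfolding deceptive_def by auto
  with prob_Un_le[OF prob_Un_le[OF 2 3] 1] show ?thesis by simp
qed

section \<open>Survivor sets are typically good\<close>

lemma prob_replicate_pmf_avoid:
  assumes "c \<le> measure_pmf.prob p A"
  shows "measure_pmf.prob (replicate_pmf m p) {xs. \<forall>x\<in>set xs. x \<notin> A} \<le> (1 - c) ^ m"
proof -
  have "{xs. \<forall>x\<in>set xs. x \<notin> A} = {xs. set xs \<subseteq> - A}" by auto
  moreover have "measure_pmf.prob p (- A) = 1 - measure_pmf.prob p A"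
    using measure_pmf.prob_compl[of A p] by (simp add: Compl_eq_Diff_UNIV)
  ultimately show ?thesis
    using assms by (simp add: prob_replicate_pmf_all power_mono)
qed

text \<open>Hoeffding's inequality for the binomial law of the intersection. The map
  \<open>h\<close> stands for \<open>fst\<close> or \<open>snd\<close>, so one argument serves rows
  and columns.\<close>

lemma prob_survivors_overlap:
  assumes p: "0 \<le> p" "p \<le> 1" and "0 < s" and h: "map_pmf h W = survivors p s"
    and tu: "t < m" "u < m" "t \<noteq> u"
  defines "c \<equiv> (1 - p)\<^sup>2"
  shows "measure_pmf.prob (replicate_pmf m W)
      {xs. \<not> \<bar>real (card (h (xs ! t) \<inter> h (xs ! u))) - c * s\<bar> \<le> c * s / 5}
    \<le> 2 * exp (- 2 * (c * s / 5)\<^sup>2 / s)"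
proof -
  have c: "c \<in> {0..1}"
    using p by (auto simp: c_def power_le_one)
  have "map_pmf (\<lambda>xs. card (h (xs ! t) \<inter> h (xs ! u))) (replicate_pmf m W)
      = map_pmf (\<lambda>(I, J). card (I \<inter> J)) (map_pmf (\<lambda>(x, y). (h x, h y))
          (map_pmf (\<lambda>xs. (xs ! t, xs ! u)) (replicate_pmf m W)))"
    by (simp add: pmf.map_comp o_def case_prod_unfold)
  also have "\<dots> = map_pmf (\<lambda>(I, J). card (I \<inter> J)) (pair_pmf (survivors p s) (survivors p s))"
    unfolding map_nth_nth_replicate_pmf[OF tu] map_pair h ..
  also have "\<dots> = binomial_pmf s c"
    unfolding c_def using p by (rule card_survivors_Int)
  finally have law: "map_pmf (\<lambda>xs. card (h (xs ! t) \<inter> h (xs ! u))) (replicate_pmf m W) = binomial_pmf s c" .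
  have "measure_pmf.prob (replicate_pmf m W)
      {xs. \<not> \<bar>real (card (h (xs ! t) \<inter> h (xs ! u))) - c * s\<bar> \<le> c * s / 5}
    = measure_pmf.prob (binomial_pmf s c) {k. \<not> \<bar>real k - c * s\<bar> \<le> c * s / 5}"
    unfolding law[symmetric] by (simp add: vimage_def)
  also have "\<dots> \<le> measure_pmf.prob (binomial_pmf s c) {k. \<bar>real k - s * c\<bar> \<ge> c * s / 5}"
    by (intro measure_pmf.finite_measure_mono) (auto simp: mult.commute)
  also have "\<dots> \<le> 2 * exp (- 2 * (c * s / 5)\<^sup>2 / s)"
    using c \<open>0 < s\<close> by (intro binomial_distribution.prob_abs_ge binomial_distribution.intro) auto
  finally show ?thesis .
qed

text \<open>The first summand is a union bound over pairs of traces for the overlaps. The second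
  treats the three covering conditions: a single trace covers a given pair of indices with
  probability at least \<open>c\<close>, and the traces are independent.\<close>

lemma prob_not_good:
  assumes p: "0 \<le> p" "p \<le> 1" and s: "0 < s"
  defines "c \<equiv> (1 - p)\<^sup>2"
  shows "measure_pmf.prob (replicate_pmf m (pair_pmf (survivors p s) (survivors p s)))
      {IJ. \<not> good c s IJ}
    \<le> real m ^ 2 * (4 * exp (- 2 * (c * s / 5)\<^sup>2 / s)) + 3 * (real s ^ 2 * (1 - c) ^ m)"
proof -
  let ?W = "pair_pmf (survivors p s) (survivors p s)"
  let ?R = "replicate_pmf m ?W"
  let ?P = "{(t, u). t < m \<and> u < m \<and> t \<noteq> u}" and ?e = "2 * exp (- 2 * (c * s / 5)\<^sup>2 / s)"
  let ?A = "\<lambda>h (t, u). {xs. \<not> \<bar>real (card (h (xs ! t) \<inter> h (xs ! u))) - c * s\<bar> \<le> c * s / 5}"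
  let ?O = "\<Union>tu\<in>?P. ?A fst tu \<union> ?A snd tu"
  let ?N = "\<lambda>T. \<Union>ij\<in>{..<s} \<times> {..<s}. {xs. \<forall>x\<in>set xs. x \<notin> T ij}"
  let ?T1 = "\<lambda>(i, j). {(I, J). i \<in> I \<and> j \<in> J}"
  let ?T2 = "\<lambda>(i, j). {(I, J). i \<in> I \<and> j \<in> I}"
  let ?T3 = "\<lambda>(i, j). {(I, J). i \<in> J \<and> j \<in> J}"
  have "measure_pmf.prob ?R ?O \<le> card ?P * (2 * ?e)"
  proof (rule prob_UN_le)
    show "finite ?P" by (rule finite_distinct_pairs)
    fix tu assume "tu \<in> ?P"
    then obtain t u where tu: "tu = (t, u)" "t < m" "u < m" "t \<noteq> u" by auto
    have "measure_pmf.prob ?R (?A fst tu \<union> ?A snd tu) \<le> ?e + ?e"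
      unfolding tu(1) split_conv c_def
      by (intro prob_Un_le prob_survivors_overlap[OF p s _ tu(2-4)] map_fst_pair_pmf map_snd_pair_pmf)
    then show "measure_pmf.prob ?R (?A fst tu \<union> ?A snd tu) \<le> 2 * ?e"
      by simp
  qed
  also have "card ?P * (2 * ?e) \<le> real m ^ 2 * (2 * ?e)"
    by (intro mult_right_mono card_distinct_pairs_le) simp
  finally have O: "measure_pmf.prob ?R ?O \<le> real m ^ 2 * (2 * ?e)" .
  have N: "measure_pmf.prob ?R (?N T) \<le> real s ^ 2 * (1 - c) ^ m"
    if "\<And>i j. i < s \<Longrightarrow> j < s \<Longrightarrow> c \<le> measure_pmf.prob ?W (T (i, j))" for T
  proof -
    have "measure_pmf.prob ?R (?N T) \<le> card ({..<s} \<times> {..<s}) * (1 - c) ^ m"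
      using that by (intro prob_UN_le prob_replicate_pmf_avoid) auto
    then show ?thesis by (simp add: power2_eq_square)
  qed
  \<comment> \<open>For \<open>i = j\<close> only one survival is required, which is at least as
    likely as two.\<close>
  have two: "c \<le> (1 - p) ^ card {i, j}" for i j :: nat
    using p by (cases "i = j") (simp_all add: c_def power2_eq_square mult_left_le)
  have sup: "measure_pmf.prob (survivors p s) {I. S \<subseteq> I} = (1 - p) ^ card S" if "S \<subseteq> {..<s}" for S
    using p that by (rule prob_survivors_superset)
  have T1: "c \<le> measure_pmf.prob ?W (?T1 (i, j))" if "i < s" "j < s" for i j
  proof -
    have "?T1 (i, j) = {I. {i} \<subseteq> I} \<times> {J. {j} \<subseteq> J}" by auto
    moreover have "{i} \<subseteq> {..<s}" "{j} \<subseteq> {..<s}" using that by auto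
    ultimately show ?thesis
      by (simp only: prob_pair_pmf_Times sup) (simp add: c_def power2_eq_square)
  qed
  have T2: "c \<le> measure_pmf.prob ?W (?T2 (i, j))" if "i < s" "j < s" for i j
  proof -
    have eq: "?T2 (i, j) = {I. {i, j} \<subseteq> I} \<times> UNIV" by auto
    have sub: "{i, j} \<subseteq> {..<s}" using that by auto
    show ?thesis
      unfolding eq prob_pair_pmf_Times sup[OF sub] using two[of i j] by simp
  qed
  have T3: "c \<le> measure_pmf.prob ?W (?T3 (i, j))" if "i < s" "j < s" for i j
  proof -
    have eq: "?T3 (i, j) = UNIV \<times> {I. {i, j} \<subseteq> I}" by auto
    have sub: "{i, j} \<subseteq> {..<s}" using that by auto
    show ?thesis
      unfolding eq prob_pair_pmf_Times sup[OF sub] using two[of i j] by simp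
  qed
  have "measure_pmf.prob ?R {IJ. \<not> good c s IJ}
      \<le> measure_pmf.prob ?R (?O \<union> (?N ?T1 \<union> (?N ?T2 \<union> ?N ?T3)))"
  \<comment> \<open>The inclusion holds only on the support, where the list has length
    \<open>m\<close> and its sets lie in \<open>{..<s}\<close>.\<close>
  proof (intro measure_pmf.finite_measure_mono_AE)
    have "IJ \<in> ?O \<union> (?N ?T1 \<union> (?N ?T2 \<union> ?N ?T3))"
      if IJ: "IJ \<in> set_pmf ?R" and bad: "\<not> good c s IJ" for IJ
    proof -
      have len: "length IJ = m" and "set IJ \<subseteq> set_pmf ?W"
        using IJ by (auto simp: set_replicate_pmf)
      then have "set IJ \<subseteq> Pow {..<s} \<times> Pow {..<s}"
        using survivors_subset[of _ p s] by fastforce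
      moreover have cover: "\<forall>i<s. \<forall>j<s. \<exists>x\<in>set IJ. x \<in> T (i, j)" if "IJ \<notin> ?N T" for T
        using that by auto
      moreover have "\<forall>t<length IJ. \<forall>u<length IJ. t \<noteq> u \<longrightarrow>
          \<bar>real (card (fst (IJ ! t) \<inter> fst (IJ ! u))) - c * s\<bar> \<le> c * s / 5 \<and>
          \<bar>real (card (snd (IJ ! t) \<inter> snd (IJ ! u))) - c * s\<bar> \<le> c * s / 5" if "IJ \<notin> ?O"
        using that len by auto
      ultimately show ?thesis
        using bad cover[of ?T1, unfolded split_conv mem_Collect_eq]
          cover[of ?T2, unfolded split_conv mem_Collect_eq]
          cover[of ?T3, unfolded split_conv mem_Collect_eq]
        unfolding good_def Un_iff by argo
    qed
    then show "AE IJ in ?R. IJ \<in> {IJ. \<not> good c s IJ} \<longrightarrow> IJ \<in> ?O \<union> (?N ?T1 \<union> (?N ?T2 \<union> ?N ?T3))"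
      by (auto simp: AE_measure_pmf_iff)
  qed simp
  also have "\<dots> \<le> real m ^ 2 * (2 * ?e) +
      (real s ^ 2 * (1 - c) ^ m + (real s ^ 2 * (1 - c) ^ m + real s ^ 2 * (1 - c) ^ m))"
    by (intro prob_Un_le O N T1 T2 T3)
  finally show ?thesis by (simp add: mult_ac)
qed


section \<open>Reconstruction\<close>

text \<open>The argument \<open>n\<close> is the number \<open>s\<^sup>2\<close> of entries, not the side length.\<close>
definition decode :: "real \<Rightarrow> nat \<Rightarrow> bool mat list \<Rightarrow> bool mat" where
  "decode c n Ys = (SOME X'. \<exists>s IJ. s\<^sup>2 = n \<and> X' \<in> carrier_mat s s \<and> good c s IJ \<and>
     Ys = map (\<lambda>(I, J). submatrix X' I J) IJ)"

text \<open>The true matrix is an admissible choice, and \<open>traces_determine\<close> makes it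
  the only one; equal squares force equal side lengths.\<close>

lemma decode_correct:
  assumes "good c s IJ" "\<not> deceptive c s K IJ x"
  shows "decode c (s\<^sup>2) (map (\<lambda>(I, J). submatrix (mat s s x) I J) IJ) = mat s s x"
  unfolding decode_def
proof (rule some_equality)
  show "\<exists>s' IJ'. s'\<^sup>2 = s\<^sup>2 \<and> mat s s x \<in> carrier_mat s' s' \<and> good c s' IJ' \<and>
      map (\<lambda>(I, J). submatrix (mat s s x) I J) IJ = map (\<lambda>(I, J). submatrix (mat s s x) I J) IJ'"
    using assms(1) by (intro exI[of _ s] exI[of _ IJ]) simp
next
  fix X' assume "\<exists>s' IJ'. s'\<^sup>2 = s\<^sup>2 \<and> X' \<in> carrier_mat s' s' \<and> good c s' IJ' \<and>
      map (\<lambda>(I, J). submatrix (mat s s x) I J) IJ = map (\<lambda>(I, J). submatrix X' I J) IJ'"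
  then obtain IJ' where "X' \<in> carrier_mat s s" "good c s IJ'"
    "map (\<lambda>(I, J). submatrix (mat s s x) I J) IJ = map (\<lambda>(I, J). submatrix X' I J) IJ'"
    by auto
  with assms show "X' = mat s s x"
    by (intro traces_determine)
qed

lemma replicate_map_pmf: "replicate_pmf m (map_pmf f p) = map_pmf (map f) (replicate_pmf m p)"
  by (induction m)
    (simp_all add: map_pmf_def bind_assoc_pmf bind_return_pmf)

text \<open>This exposes the survivor sets hidden by the channel. They are independent of the bits,
  so channel and matrix can be estimated one after the other.\<close>

lemma matrix_and_traces_eq:
  "matrix_and_traces p s m =
     map_pmf (\<lambda>(x, IJ). (mat s s x, map (\<lambda>(I, J). submatrix (mat s s x) I J) IJ))
       (pair_pmf (fair_bits ({..<s} \<times> {..<s}))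
         (replicate_pmf m (pair_pmf (survivors p s) (survivors p s))))"
proof -
  define W where "W = pair_pmf (survivors p s) (survivors p s)"
  have "matrix_deletion_channel p (mat s s x) = map_pmf (\<lambda>(I, J). submatrix (mat s s x) I J) W" for x
    by (simp add: matrix_deletion_channel_def W_def pair_pmf_def map_pmf_def bind_assoc_pmf bind_return_pmf)
  then have "matrix_and_traces p s m = fair_bits ({..<s} \<times> {..<s}) \<bind> (\<lambda>x.
      map_pmf (map (\<lambda>(I, J). submatrix (mat s s x) I J)) (replicate_pmf m W) \<bind> (\<lambda>Ys.
      return_pmf (mat s s x, Ys)))"
    by (simp only: matrix_and_traces_def random_matrix_def bind_map_pmf replicate_map_pmf)
  then show ?thesis
    unfolding W_def[symmetric]
    by (simp add: pair_pmf_def map_pmf_def bind_assoc_pmf bind_return_pmf)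
qed

lemma prob_decode:
  fixes p :: real and K :: nat
  assumes p: "0 \<le> p" "p \<le> 1" and s: "0 < s"
  defines "c \<equiv> (1 - p)\<^sup>2"
  shows "1 - measure_pmf.prob (matrix_and_traces p s m) {(X, Ys). decode c (s\<^sup>2) Ys = X}
    \<le> real m ^ 2 * (4 * exp (- 2 * (c * s / 5)\<^sup>2 / s)) + 3 * (real s ^ 2 * (1 - c) ^ m) +
      (2 * 2 powr (8 * real s - K * (4/5 * c * s)) +
       real m ^ 2 * (2 * (real s ^ 2 *
         ((3 / 2) powr (6/5 * c * s) / 2 powr (4/5 * c * s - 2 * real K)))))"
    (is "_ \<le> ?e1 + ?e2")
proof -
  let ?U = "fair_bits ({..<s} \<times> {..<s})"
  let ?R = "replicate_pmf m (pair_pmf (survivors p s) (survivors p s))"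
  let ?E = "{(x, IJ). decode c (s\<^sup>2) (map (\<lambda>(I, J). submatrix (mat s s x) I J) IJ) = mat s s x}"
  let ?A = "{(x, IJ). \<not> good c s IJ}"
  \<comment> \<open>The length is recorded because the bound on \<open>deceptive\<close> depends on
    it and must be uniform in \<open>IJ\<close>.\<close>
  let ?B = "{(x, IJ). (good c s IJ \<and> length IJ = m) \<and> deceptive c s K IJ x}"
  have "measure_pmf.prob (matrix_and_traces p s m) {(X, Ys). decode c (s\<^sup>2) Ys = X}
      = measure_pmf.prob (pair_pmf ?U ?R) ?E"
    by (simp add: matrix_and_traces_eq vimage_def case_prod_unfold)
  then have "1 - measure_pmf.prob (matrix_and_traces p s m) {(X, Ys). decode c (s\<^sup>2) Ys = X}
      = measure_pmf.prob (pair_pmf ?U ?R) (- ?E)"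
    using measure_pmf.prob_compl[of ?E "pair_pmf ?U ?R"] by (simp add: Compl_eq_Diff_UNIV)
  also have "\<dots> \<le> measure_pmf.prob (pair_pmf ?U ?R) (?A \<union> ?B)"
  proof (rule measure_pmf.finite_measure_mono_AE)
    show "AE z in pair_pmf ?U ?R. z \<in> - ?E \<longrightarrow> z \<in> ?A \<union> ?B"
      using decode_correct[of c s _ K] by (auto simp: AE_measure_pmf_iff set_replicate_pmf)
  qed simp
  also have "\<dots> \<le> ?e1 + ?e2"
  proof (rule prob_Un_le)
    have A: "?A = UNIV \<times> {IJ. \<not> good c s IJ}" by auto
    have "measure_pmf.prob (pair_pmf ?U ?R) ?A = measure_pmf.prob ?R {IJ. \<not> good c s IJ}"
      unfolding A prob_pair_pmf_Times by simp
    also have "\<dots> \<le> ?e1"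
      unfolding c_def using p s by (rule prob_not_good)
    finally show "measure_pmf.prob (pair_pmf ?U ?R) ?A \<le> ?e1" .
    show "measure_pmf.prob (pair_pmf ?U ?R) ?B \<le> ?e2"
    proof (rule prob_pair_pmf_le)
      fix IJ assume "good c s IJ \<and> length IJ = m"
      then show "measure_pmf.prob ?U {x. deceptive c s K IJ x} \<le> ?e2"
        using prob_deceptive[of c s IJ K] by (simp add: c_def)
    qed simp
  qed
  finally show ?thesis .
qed

section \<open>Constants and asymptotics\<close>

lemma ln_three_halves_less: "6/5 * ln (3 / 2) < 4/5 * ln (2 :: real)"
proof -
  \<comment> \<open>The claim reduces to \<open>(3 / 2) ^ 3 = 27 / 8 < 4 = 2 ^ 2\<close>.\<close>
  have "3 * ln (3 / 2) = ln ((3 / 2 :: real) ^ 3)"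
    by (simp add: ln_realpow)
  also have "\<dots> < ln (2 ^ 2)"
    by (subst ln_less_cancel_iff) (simp_all add: power_divide)
  also have "\<dots> = 2 * ln (2 :: real)"
    by (subst ln_realpow) simp_all
  finally show ?thesis by simp
qed

lemma error_tendsto_0:
  fixes a b d C :: real
  assumes "0 < a" "0 < b" "0 < d" "0 < C"
  shows "(\<lambda>s :: nat. (d * ln s + 1)\<^sup>2 * (4 * exp (- a * s)) + 3 * (real s ^ 2 * real s powr -4) +
    (2 * 2 powr (- 4 * real s) + (d * ln s + 1)\<^sup>2 * (2 * (real s ^ 2 * (C * exp (- b * s)))))) \<longlonglongrightarrow> 0"
proof -
  have "(\<lambda>s :: nat. (d * ln s + 1)\<^sup>2 * (4 * exp (- a * s))) \<longlonglongrightarrow> 0"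
    using assms by real_asymp
  moreover have "(\<lambda>s :: nat. 3 * (real s ^ 2 * real s powr -4)) \<longlonglongrightarrow> 0"
    by real_asymp
  moreover have "(\<lambda>s :: nat. 2 * 2 powr (- 4 * real s)) \<longlonglongrightarrow> 0"
    by real_asymp
  moreover have "(\<lambda>s :: nat. (d * ln s + 1)\<^sup>2 * (2 * (real s ^ 2 * (C * exp (- b * s))))) \<longlonglongrightarrow> 0"
    using assms by real_asymp
  ultimately show ?thesis
    by (intro tendsto_add_zero)
qed

theorem theorem5:
  fixes p :: real
  assumes "0 \<le> p" and "p < 1"
  shows "\<exists>(T :: nat \<Rightarrow> nat) (R :: nat \<Rightarrow> bool mat list \<Rightarrow> bool mat).
           (\<lambda>n. real (T n)) \<in> O(\<lambda>n. ln (real n)) \<and>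
           (\<lambda>s. measure_pmf.prob (matrix_and_traces p s (T (s\<^sup>2))) {(X, Ys). R (s\<^sup>2) Ys = X})
             \<longlonglongrightarrow> 1"
proof -
  define c where "c = (1 - p)\<^sup>2"
  \<comment> \<open>For \<open>n = s\<^sup>2\<close> this is at least \<open>4 / c * ln s\<close>
    traces, hence \<open>(1 - c) ^ m \<le> s powr -4\<close>, which beats the
    \<open>s\<^sup>2\<close> index pairs to be covered.\<close>
  define T where "T n = nat \<lceil>2 / c * ln (real n)\<rceil>" for n
  \<comment> \<open>With \<open>K * c \<ge> 15\<close> the exponent
    \<open>8 * s - K * (4/5 * c * s)\<close> is at most
    \<open>8 * s - 12 * s = - 4 * s\<close>.\<close>
  define K where "K = nat \<lceil>15 / c\<rceil>"
  \<comment> \<open>The three constants rewrite the remaining error terms: \<open>a\<close> is the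
    Hoeffding rate, \<open>b\<close> the decay rate for similar rows, and \<open>C\<close> the price
    of giving up \<open>2 * K\<close> columns, which stays constant in \<open>s\<close>.\<close>
  define a where "a = 2 * c\<^sup>2 / 25"
  define b where "b = c * (4/5 * ln 2 - 6/5 * ln (3 / 2))"
  define C :: real where "C = 2 powr (2 * real K)"
  have c: "0 < c" "c \<le> 1"
    using assms by (auto simp: c_def power_le_one)
  have pos: "0 < a" "0 < b" "0 < 4 / c" "0 < C"
    using c ln_three_halves_less by (simp_all add: a_def b_def C_def)
  let ?e = "\<lambda>s :: nat. (4 / c * ln s + 1)\<^sup>2 * (4 * exp (- a * s)) + 3 * (real s ^ 2 * real s powr -4) +
    (2 * 2 powr (- 4 * real s) + (4 / c * ln s + 1)\<^sup>2 * (2 * (real s ^ 2 * (C * exp (- b * s)))))"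
  let ?P = "\<lambda>s. measure_pmf.prob (matrix_and_traces p s (T (s\<^sup>2))) {(X, Ys). decode c (s\<^sup>2) Ys = X}"
  have bound: "1 - ?P s \<le> ?e s" if s: "0 < s" for s
  proof -
    define m where "m = T (s\<^sup>2)"
    have ln: "0 \<le> ln (real s)" using s by simp
    have lns: "2 / c * ln (real (s\<^sup>2)) = 4 / c * ln (real s)"
      using s by (simp add: ln_realpow)
    then have m: "real m \<le> 4 / c * ln s + 1" "4 / c * ln s \<le> m"
      using ln c unfolding m_def T_def by (simp_all only: lns) simp_all
    have m2: "real m ^ 2 \<le> (4 / c * ln s + 1)\<^sup>2"
      using m by (intro power_mono) auto
    \<comment> \<open>This is \<open>1 - c \<le> exp (- c)\<close>, raised to the power
      \<open>m\<close>.\<close>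
    have "(1 - c) ^ m \<le> exp (- c) ^ m"
      using c exp_ge_add_one_self[of "- c"] by (intro power_mono) auto
    also have "\<dots> = exp (- c * m)"
      using exp_of_nat_mult[of m "- c"] by (simp add: mult.commute)
    also have "\<dots> \<le> exp (- 4 * ln s)"
      using m(2) c by (simp add: field_simps)
    also have "\<dots> = real s powr -4"
      using s by (simp add: powr_def)
    finally have 1: "(1 - c) ^ m \<le> real s powr -4" .
    have 2: "exp (- 2 * (c * s / 5)\<^sup>2 / s) = exp (- a * s)"
      using s by (simp add: a_def power2_eq_square field_simps)
    have "15 / c \<le> K"
      by (simp add: K_def) linarith
    then have "15 \<le> K * c"
      using c by (simp add: field_simps)
    then have "15 * real s \<le> K * c * s"
      by (intro mult_right_mono) auto
    then have 3: "2 powr (8 * real s - K * (4/5 * c * s)) \<le> 2 powr (- 4 * real s)"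
      by (intro powr_mono) (auto simp: mult_ac)
    have 4: "(3 / 2) powr (6/5 * c * s) / 2 powr (4/5 * c * s - 2 * real K) = C * exp (- b * s)"
      by (simp add: C_def b_def powr_def algebra_simps flip: exp_add exp_diff)
    have "1 - ?P s \<le> real m ^ 2 * (4 * exp (- 2 * (c * s / 5)\<^sup>2 / s)) + 3 * (real s ^ 2 * (1 - c) ^ m) +
      (2 * 2 powr (8 * real s - K * (4/5 * c * s)) +
       real m ^ 2 * (2 * (real s ^ 2 *
         ((3 / 2) powr (6/5 * c * s) / 2 powr (4/5 * c * s - 2 * real K)))))"
      unfolding c_def m_def using assms s by (intro prob_decode) auto
    also have "\<dots> \<le> ?e s"
      unfolding 2 4
    proof (intro add_mono mult_mono)
      show "0 \<le> (1 - c) ^ m"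
        using c by simp
      show "0 \<le> real s ^ 2 * (1 - c) ^ m"
        using c by simp
    qed (use m2 1 3 pos in simp_all)
    finally show ?thesis .
  qed
  have "?P \<longlonglongrightarrow> 1"
  proof (rule tendsto_sandwich)
    show "eventually (\<lambda>s. 1 - ?e s \<le> ?P s) sequentially"
    proof (rule eventually_mono[OF eventually_gt_at_top[of 0]])
      have swap: "1 - y \<le> x" if "1 - x \<le> y" for x y :: real
        using that by simp
      show "1 - ?e s \<le> ?P s" if "0 < s" for s
        by (rule swap[OF bound[OF that]])
    qed
    show "(\<lambda>s. 1 - ?e s) \<longlonglongrightarrow> 1"
      using tendsto_diff[OF tendsto_const error_tendsto_0[OF pos], of 1] by simp
  qed (auto simp: measure_pmf.prob_le_1)
  moreover have "(\<lambda>n. real (T n)) \<in> O(\<lambda>n. ln (real n))"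
  proof (rule landau_o.big_trans)
    \<comment> \<open>The summand \<open>1\<close> absorbs the rounding up in
      \<open>T\<close>.\<close>
    show "(\<lambda>n. real (T n)) \<in> O(\<lambda>n. 2 / c * ln (real n) + 1)"
    proof (rule bigoI[of _ 1], rule eventually_mono[OF eventually_gt_at_top[of 0]])
      fix n :: nat assume "0 < n"
      then have "0 \<le> 2 / c * ln (real n)" using c by simp
      then show "norm (real (T n)) \<le> 1 * norm (2 / c * ln (real n) + 1)"
        unfolding T_def by simp
    qed
    show "(\<lambda>n. 2 / c * ln (real n) + 1) \<in> O(\<lambda>n. ln (real n))"
      using c by real_asymp
  qed
  ultimately show ?thesis by blast
qed

end
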